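(* For a Heyting algebra $\mathbf H$, consider on triples $(a,u,x)$ of elements of $\mathbf H$ with $a\le u\wedge x$ the operation $$(a,u,x)\otimes(b,v,y)=\bigl(a\wedge b,\ u\wedge v,\ (v\rightarrow x)\wedge(u\rightarrow y)\bigr).$$ This operation validates contraction in $\mathrm{D}$ and refutes it in $\mathrm{G}$: for every Heyting algebra $\mathbf H$ and every $\alpha\in\mathrm{D}(\mathbf H)$ one has $\alpha\le\alpha\otimes\alpha$ in $\mathrm{D}(\mathbf H)$, whereas in $\mathrm{G}(\mathbf 2)$ the element $b=(0,0,0)$ satisfies $b\otimes b=(0,0,1)$, which is the least element of $\mathrm{G}(\mathbf 2)$, and $b\nleq b\otimes b$.
   Context: For a Heyting algebra $\mathbf H$, both $\mathrm{D}(\mathbf H)$ and $\mathrm{G}(\mathbf H)$ have as elements the triples $(a,u,x)$ of elements of $\mathbf H$ with $a\le u\wedge x$. In $\mathrm{D}(\mathbf H)$, $(a,u,x)\le(b,v,y)$ iff $u\le v$, $u\wedge y\le x$, and $a\wedge(u\wedge y)\le b\wedge(u\wedge y)$. In $\mathrm{G}(\mathbf H)$, $(a,u,x)\le(b,v,y)$ iff $u\le v$, $y\le x$, and $a\wedge(u\wedge y)\le b\wedge(u\wedge y)$. $\mathbf 2=\{0<1\}$ is the two-element Boolean algebra. *)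

theory Defs
  imports Main
begin

unbundle lattice_syntax

class heyting_algebra = bounded_lattice +
  fixes himp :: "'a \<Rightarrow> 'a \<Rightarrow> 'a"  (infixr "\<rightharpoonup>" 60)
  assumes himp_adjoint: "c \<sqinter> a \<le> b \<longleftrightarrow> c \<le> (a \<rightharpoonup> b)"

text \<open>The algebra \<open>2\<close> is the type \<^typ>\<open>bool\<close>, with its library order \<^prop>\<open>False < True\<close>.\<close>

instantiation bool :: heyting_algebra
begin

definition himp_bool :: "bool \<Rightarrow> bool \<Rightarrow> bool"
  where "himp_bool p q \<longleftrightarrow> (p \<longrightarrow> q)"

instance
  by standard (auto simp: himp_bool_def)

end

type_synonym 'a triple = "'a \<times> 'a \<times> 'a"

text \<open>The common set of elements of \<open>D(H)\<close> and \<open>G(H)\<close>; the two structures differ only in the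
  relations \<open>D_le\<close> and \<open>G_le\<close> below, which are meaningful for arguments in this set.
  In general \<open>D_le\<close> is only a preorder.\<close>

definition triples :: "'a::heyting_algebra triple set"
  where "triples = {(a, u, x). a \<le> u \<sqinter> x}"

fun D_le :: "'a::heyting_algebra triple \<Rightarrow> 'a triple \<Rightarrow> bool"
  where "D_le (a, u, x) (b, v, y) \<longleftrightarrow>
    u \<le> v \<and> u \<sqinter> y \<le> x \<and> a \<sqinter> (u \<sqinter> y) \<le> b \<sqinter> (u \<sqinter> y)"

fun G_le :: "'a::heyting_algebra triple \<Rightarrow> 'a triple \<Rightarrow> bool"
  where "G_le (a, u, x) (b, v, y) \<longleftrightarrow>
    u \<le> v \<and> y \<le> x \<and> a \<sqinter> (u \<sqinter> y) \<le> b \<sqinter> (u \<sqinter> y)"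

fun tensor :: "'a::heyting_algebra triple \<Rightarrow> 'a triple \<Rightarrow> 'a triple"  (infixl "\<otimes>" 70)
  where "(a, u, x) \<otimes> (b, v, y) = (a \<sqinter> b, u \<sqinter> v, (v \<rightharpoonup> x) \<sqinter> (u \<rightharpoonup> y))"

definition is_least_in :: "('b \<Rightarrow> 'b \<Rightarrow> bool) \<Rightarrow> 'b set \<Rightarrow> 'b \<Rightarrow> bool"
  where "is_least_in le A m \<longleftrightarrow> m \<in> A \<and> (\<forall>x\<in>A. le m x)"

lemma tensor_closed:
  assumes "\<alpha> \<in> triples" and "\<beta> \<in> triples"
  shows "\<alpha> \<otimes> \<beta> \<in> triples"
proof -
  obtain a u x b v y where [simp]: "\<alpha> = (a, u, x)" "\<beta> = (b, v, y)"
    by (metis surj_pair)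
  have *: "a \<le> u" "a \<le> x" "b \<le> v" "b \<le> y"
    using assms by (auto simp: triples_def)
  then have "(a \<sqinter> b) \<sqinter> v \<le> x" "(a \<sqinter> b) \<sqinter> u \<le> y"
    by (meson inf.coboundedI1 inf.coboundedI2)+
  then have "a \<sqinter> b \<le> (v \<rightharpoonup> x)" "a \<sqinter> b \<le> (u \<rightharpoonup> y)"
    by (simp_all only: himp_adjoint)
  moreover have "a \<sqinter> b \<le> u \<sqinter> v"
    using * by (blast intro: inf_mono)
  ultimately show ?thesis
    by (simp add: triples_def)
qed

text \<open>By antisymmetry, a least element of \<open>G(H)\<close> is unique.\<close>

lemma G_le_antisym:
  assumes "\<alpha> \<in> triples" and "\<beta> \<in> triples" and "G_le \<alpha> \<beta>" and "G_le \<beta> \<alpha>"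
  shows "\<alpha> = \<beta>"
proof -
  obtain a u x b v y where [simp]: "\<alpha> = (a, u, x)" "\<beta> = (b, v, y)"
    by (metis surj_pair)
  have "u = v" "x = y"
    using assms(3,4) by auto
  with assms show ?thesis
    by (auto simp: triples_def inf.absorb1 intro: antisym)
qed

end

theory Submission
  imports Defs
begin

text \<open>
  Squaring replaces the third component \<open>x\<close> by \<open>u \<rightharpoonup> x\<close> and leaves the first two unchanged.
  The preorder of \<open>D(H)\<close> compares third components only below the second component \<open>u\<close> of the
  smaller triple, and there modus ponens, \<open>u \<sqinter> (u \<rightharpoonup> x) \<le> x\<close>, makes \<open>x\<close> and \<open>u \<rightharpoonup> x\<close>
  indistinguishable; hence contraction. The order of \<open>G(H)\<close> compares them outright and would need
  \<open>u \<rightharpoonup> x \<le> x\<close>. This fails in \<open>2\<close> at \<open>u = x = 0\<close>, where \<open>0 \<rightharpoonup> 0 = 1\<close>.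
\<close>

lemma inf_himp_le: "u \<sqinter> (u \<rightharpoonup> x) \<le> (x :: 'a::heyting_algebra)"
  by (subst inf_commute) (simp add: himp_adjoint)

lemma tensor_self:
  "(a, u, x) \<otimes> (a, u, x) = (a, u, u \<rightharpoonup> (x :: 'a::heyting_algebra))"
  by simp

lemma D_le_tensor_self: "D_le \<alpha> (\<alpha> \<otimes> \<alpha>)"
proof (cases \<alpha>)
  case (fields a u x)
  then show ?thesis
    by (simp only: tensor_self D_le.simps inf_himp_le order_refl simp_thms)
qed

theorem mainTheorem4:
  shows "(\<forall>\<alpha>\<in>(triples :: 'a::heyting_algebra triple set).
            \<alpha> \<otimes> \<alpha> \<in> triples \<and> D_le \<alpha> (\<alpha> \<otimes> \<alpha>)) \<and>
         (let b = (False, False, False) in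
            b \<in> triples \<and>
            b \<otimes> b = (False, False, True) \<and>
            is_least_in G_le triples (False, False, True) \<and>
            \<not> G_le b (b \<otimes> b))"
proof -
  have "is_least_in G_le triples (False, False, True)"
    by (auto simp: is_least_in_def triples_def)
  moreover have "(False, False, False) \<in> triples"
    by (simp add: triples_def)
  ultimately show ?thesis
    by (simp add: Let_def himp_bool_def) (blast intro: tensor_closed D_le_tensor_self)
qed

end
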